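(* Let $V=\{1,\dots,n\}$ and let $\mathcal{W}\subseteq\mathbb{R}^{n\times n}_+$ be a set of symmetric entrywise nonnegative matrices. Let $\mathrm{Val(RP)}=\tfrac12\max_{y\in\{-1,1\}^n}\min_{W\in\mathcal{W}}\sum_{i<j}w_{ij}(1-y_iy_j)$. Let $\hat Y$ be an optimal solution of $\max_{Y\succeq0,\,Y_{ii}=1}\min_{W\in\mathcal{W}}\frac14\langle W,\mathbf{1}-Y\rangle$ ($\mathbf{1}$ the all-ones matrix), let $\hat u_1,\dots,\hat u_n\in S_n$ be the columns of a factor $U$ with $\hat Y=U^TU$, draw $r$ uniformly from the unit sphere $S_n\subseteq\mathbb{R}^n$, and set $\hat y_i=1$ if $\hat u_i\cdot r\ge0$, $\hat y_i=-1$ otherwise. For $W\in\mathcal{W}$ let $\hat C(W)=\sum_{i<j}w_{ij}\frac{1-\hat y_i\hat y_j}{2}$ and $W_{tot}=\sum_{i<j}w_{ij}$. Let $$\tilde A=\min_{W\in\mathcal{W}}\frac{1}{W_{tot}}\sum_{i<j}w_{ij}\frac{1-\hat u_i\cdot\hat u_j}{2},\qquad h(t)=\frac{\arccos(1-2t)}{\pi}.$$ If $\tilde A\ge\gamma$, where $\gamma\approx0.84458$ is the minimizer of $h(t)/t$ over $t\in(0,1]$, then $$\mathbb{E}[\hat C(W)]\ \ge\ \frac{h(\tilde A)}{\tilde A}\,\mathrm{Val(RP)}\quad\text{for all }W\in\mathcal{W},$$ where the expectation is over $r$.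
   Context: Robust max-cut with the Goemans–Williamson rounding algorithm, in the case where the (relative) SDP cut value is large. Standing assumptions: problems well-posed with finite optimal values, inner minima attained, $W_{tot}>0$ for $W\in\mathcal{W}$, expectations well-defined. *)

theory Defs
  imports "HOL-Probability.Probability"
begin

text \<open>
  The vertex set is the finite well-ordered index type \<open>'n\<close>; its order is only used to
  write \<open>i < j\<close>. Robust values are written with \<open>INF\<close>; the theorem assumes that each such
  infimum is attained, so that it is a minimum.
\<close>

definition total_weight :: "real ^ 'n::{finite,wellorder} ^ 'n::_ \<Rightarrow> real"
  where "total_weight W = (\<Sum>(i, j) \<in> {(i, j). i < j}. W $ i $ j)"

definition cut_value :: "real ^ 'n::{finite,wellorder} ^ 'n::_ \<Rightarrow> real ^ 'n::_ \<Rightarrow> real"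
  where "cut_value W y = (\<Sum>(i, j) \<in> {(i, j). i < j}. W $ i $ j * ((1 - y $ i * y $ j) / 2))"

definition sign_vectors :: "(real ^ 'n) set"
  where "sign_vectors = {y. \<forall>i. y $ i \<in> {-1, 1}}"

definition rp_objective :: "real ^ 'n::{finite,wellorder} \<Rightarrow> real ^ 'n::_ ^ 'n::_ \<Rightarrow> real"
  where "rp_objective y W = (\<Sum>(i, j) \<in> {(i, j). i < j}. W $ i $ j * (1 - y $ i * y $ j))"

definition rp_value :: "(real ^ 'n::{finite,wellorder} ^ 'n::_) set \<Rightarrow> real"
  where "rp_value \<W> = 1/2 * Max ((\<lambda>y. INF W \<in> \<W>. rp_objective y W) ` sign_vectors)"

definition positive_semidefinite :: "real ^ 'n ^ 'n \<Rightarrow> bool"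
  where "positive_semidefinite Y \<longleftrightarrow> transpose Y = Y \<and> (\<forall>x. 0 \<le> x \<bullet> (Y *v x))"

definition sdp_feasible :: "real ^ 'n ^ 'n \<Rightarrow> bool"
  where "sdp_feasible Y \<longleftrightarrow> positive_semidefinite Y \<and> (\<forall>i. Y $ i $ i = 1)"

text \<open>On \<open>real ^ 'n ^ 'n\<close> the library inner product is the Frobenius inner product.\<close>

definition sdp_objective :: "real ^ 'n ^ 'n \<Rightarrow> real ^ 'n ^ 'n \<Rightarrow> real"
  where "sdp_objective Y W = 1/4 * (W \<bullet> ((\<chi> i j. 1) - Y))"

definition rel_sdp_cut :: "real ^ 'n::{finite,wellorder} ^ 'n::_ \<Rightarrow> real ^ 'n::_ ^ 'n::_ \<Rightarrow> real"
  where "rel_sdp_cut U W = 1 / total_weight W *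
    (\<Sum>(i, j) \<in> {(i, j). i < j}. W $ i $ j * ((1 - column i U \<bullet> column j U) / 2))"

definition gw_round :: "real ^ 'n ^ 'n \<Rightarrow> real ^ 'n \<Rightarrow> real ^ 'n"
  where "gw_round U r = (\<chi> i. if column i U \<bullet> r \<ge> 0 then 1 else -1)"

text \<open>
  Normalised surface measure on the unit sphere, as a measure on the ambient space: the
  measure of \<open>A\<close> is the fraction of the unit ball's volume in the cone over \<open>A\<close>.
  The centre of the ball, where the radial projection yields \<open>0\<close>, is a null set.
\<close>

definition uniform_sphere :: "'a::euclidean_space measure"
  where "uniform_sphere = distr (uniform_measure lborel (ball 0 1)) borel (\<lambda>x. x /\<^sub>R norm x)"

lemma prob_space_uniform_sphere: "prob_space (uniform_sphere :: 'a::euclidean_space measure)"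
proof -
  have "emeasure lborel (ball (0::'a) 1) \<noteq> 0"
    using emeasure_lborel_ball_finite[of "0::'a" 1] content_ball_pos[of 1 "0::'a"]
    by (auto simp: measure_def)
  moreover have "emeasure lborel (ball (0::'a) 1) \<noteq> \<infinity>"
    using emeasure_lborel_ball_finite[of "0::'a" 1] by simp
  ultimately show ?thesis
    unfolding uniform_sphere_def
    by (intro prob_space.prob_space_distr prob_space_uniform_measure) simp_all
qed

lemma AE_uniform_sphere: "AE r in (uniform_sphere :: 'a::euclidean_space measure). r \<in> sphere 0 1"
proof -
  have "AE x in lborel. x \<noteq> (0::'a)"
    by (rule AE_lborel_singleton)
  then have "AE x in uniform_measure lborel (ball (0::'a) 1). x /\<^sub>R norm x \<in> sphere 0 1"
    by (intro AE_uniform_measureI) (auto elim!: eventually_mono)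
  then show ?thesis
    unfolding uniform_sphere_def by (subst AE_distr_iff) auto
qed

definition gw_h :: "real \<Rightarrow> real"
  where "gw_h t = arccos (1 - 2 * t) / pi"

text \<open>Approximately \<open>0.84458\<close>.\<close>

definition gw_gamma :: real
  where "gw_gamma = (THE t. is_arg_min (\<lambda>t. gw_h t / t) (\<lambda>t. t \<in> {0<..1}) t)"

end

theory Submission
  imports Defs
begin

text \<open>
  A uniformly random hyperplane separates two unit vectors at angle \<open>\<theta>\<close> with probability
  \<open>\<theta> / pi\<close>, so rounding turns a relative SDP contribution \<open>t\<close> of an edge into \<open>gw_h t\<close>. Although
  \<open>gw_h\<close> is concave on \<open>[0, 1/2]\<close>, its tangent at any \<open>A \<in> [gw_gamma, 1)\<close> stays below \<open>gw_h\<close> on all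
  of \<open>[0, 1]\<close> and is nonpositive at \<open>0\<close>. Averaging this tangent inequality over the edges of \<open>W\<close>,
  whose mean SDP contribution is at least \<open>A\<close>, bounds the expected cut from below by
  \<open>gw_h A / A\<close> times the SDP value of \<open>W\<close>, which dominates the value of the robust problem.
\<close>

section \<open>The tangent inequality for \<open>gw_h\<close>\<close>

text \<open>Sine is the cosine of the distance to \<open>pi / 2\<close>, and cosine decreases in
  that distance.\<close>

lemma sin_less_sin_iff_closer:
  fixes x y :: real
  assumes "x \<in> {0..pi}" "y \<in> {0..pi}"
  shows "sin x < sin y \<longleftrightarrow> \<bar>y - pi / 2\<bar> < \<bar>x - pi / 2\<bar>"
proof -
  have s: "sin z = cos \<bar>z - pi / 2\<bar>" for z :: real
    by (simp add: cos_diff)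
  show ?thesis
    unfolding s using assms by (intro cos_mono_less_eq) (auto simp: abs_if)
qed

text \<open>Up to the factor \<open>pi * sin \<alpha>\<close> and an additive constant,
  \<open>x * sin \<alpha> + cos x\<close> is the gap between \<open>gw_h\<close> and its tangent
  with angle \<open>\<alpha>\<close>, as a function of the angle \<open>x\<close>. Its derivative is
  \<open>sin \<alpha> - sin x\<close>.\<close>

lemma increasing_tangent_gap:
  fixes \<alpha> a b :: real
  assumes "a < b" and "\<And>x. a < x \<Longrightarrow> x < b \<Longrightarrow> sin x < sin \<alpha>"
  shows "a * sin \<alpha> + cos a < b * sin \<alpha> + cos b"
proof (rule DERIV_pos_imp_increasing_open[OF \<open>a < b\<close>])
  fix x assume "a < x" "x < b"
  then show "\<exists>y. ((\<lambda>x. x * sin \<alpha> + cos x) has_real_derivative y) (at x) \<and> y > 0"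
    using assms(2)[of x] by (intro exI[of _ "sin \<alpha> - sin x"]) (auto intro!: derivative_eq_intros)
qed (intro continuous_intros)

lemma decreasing_tangent_gap:
  fixes \<alpha> a b :: real
  assumes "a < b" and "\<And>x. a < x \<Longrightarrow> x < b \<Longrightarrow> sin \<alpha> < sin x"
  shows "a * sin \<alpha> + cos a > b * sin \<alpha> + cos b"
proof (rule DERIV_neg_imp_decreasing_open[OF \<open>a < b\<close>])
  fix x assume "a < x" "x < b"
  then show "\<exists>y. ((\<lambda>x. x * sin \<alpha> + cos x) has_real_derivative y) (at x) \<and> y < 0"
    using assms(2)[of x] by (intro exI[of _ "sin \<alpha> - sin x"]) (auto intro!: derivative_eq_intros)
qed (intro continuous_intros)

text \<open>
  With \<open>t = (1 - cos \<theta>) / 2\<close> one has \<open>gw_h t = \<theta> / pi\<close>; the inequality says that \<open>gw_h\<close> lies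
  above its tangent at the point with angle \<open>\<alpha>\<close>, and the last hypothesis that this tangent
  is nonpositive at \<open>0\<close>.
\<close>

lemma tangent_angle_less:
  fixes \<alpha> \<theta> :: real
  assumes \<alpha>: "pi / 2 < \<alpha>" "\<alpha> \<le> pi" and \<theta>: "0 < \<theta>" "\<theta> \<le> pi" "\<theta> \<noteq> \<alpha>"
    and origin: "\<alpha> * sin \<alpha> + cos \<alpha> \<le> 1"
  shows "\<alpha> * sin \<alpha> + cos \<alpha> < \<theta> * sin \<alpha> + cos \<theta>"
proof -
  have sin_less: "sin x < sin \<alpha> \<longleftrightarrow> \<bar>\<alpha> - pi / 2\<bar> < \<bar>x - pi / 2\<bar>"
    "sin \<alpha> < sin x \<longleftrightarrow> \<bar>x - pi / 2\<bar> < \<bar>\<alpha> - pi / 2\<bar>" if "0 \<le> x" "x \<le> pi" for x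
    using that \<alpha> sin_less_sin_iff_closer[of x \<alpha>] sin_less_sin_iff_closer[of \<alpha> x] by simp_all
  \<comment> \<open>The gap function increases up to \<open>pi - \<alpha>\<close>, decreases up to
    \<open>\<alpha>\<close> and then increases again. Only 0 and \<open>\<alpha>\<close> compete for
    its minimum, and \<open>origin\<close> compares these two.\<close>
  consider "\<theta> \<le> pi - \<alpha>" | "pi - \<alpha> < \<theta>" "\<theta> < \<alpha>" | "\<alpha> < \<theta>"
    using \<theta> by linarith
  then show ?thesis
  proof cases
    case 1
    then have "0 * sin \<alpha> + cos 0 < \<theta> * sin \<alpha> + cos \<theta>"
      using \<alpha> \<theta> by (intro increasing_tangent_gap) (auto simp: sin_less abs_if)
    then show ?thesis using origin by simp
  next
    case 2
    then show ?thesis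
      using \<alpha> \<theta> by (intro decreasing_tangent_gap) (auto simp: sin_less abs_if)
  next
    case 3
    then show ?thesis
      using \<alpha> \<theta> by (intro increasing_tangent_gap) (auto simp: sin_less abs_if)
  qed
qed

text \<open>The equation says that the tangent of \<open>gw_h\<close> with angle
  \<open>\<beta>\<close> passes through the origin, the critical point condition for
  \<open>gw_h t / t\<close>. Its left side exceeds 1 at \<open>pi / 2\<close> and is -1 at
  \<open>pi\<close>.\<close>

lemma critical_angle_exists:
  obtains \<beta> :: real where "pi / 2 < \<beta>" "\<beta> < pi" "\<beta> * sin \<beta> + cos \<beta> = 1"
proof -
  have half: "1 < pi / 2" using pi_gt3 by simp
  have "\<exists>x\<ge>pi / 2. x \<le> pi \<and> x * sin x + cos x = 1"
    by (rule IVT2') (use half in \<open>auto intro!: continuous_intros\<close>)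
  then obtain \<beta> where \<beta>: "pi / 2 \<le> \<beta>" "\<beta> \<le> pi" "\<beta> * sin \<beta> + cos \<beta> = 1"
    by blast
  moreover have "\<beta> \<noteq> pi / 2" "\<beta> \<noteq> pi"
    using \<beta>(3) half by (force, force)
  ultimately show thesis
    using that[of \<beta>] by auto
qed

text \<open>The derivative is \<open>z * cos z\<close>. This carries the tangent condition from the
  angle of \<open>gw_gamma\<close> over to all larger angles.\<close>

lemma mult_sin_add_cos_antimono:
  fixes x y :: real
  assumes "pi / 2 \<le> x" "x \<le> y" "y \<le> pi"
  shows "y * sin y + cos y \<le> x * sin x + cos x"
proof (rule DERIV_nonpos_imp_nonincreasing[OF \<open>x \<le> y\<close>])
  fix z assume z: "x \<le> z" "z \<le> y"
  have "cos z \<le> 0"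
    using cos_monotone_0_pi_le[of "pi / 2" z] z assms by simp
  then have "z * cos z \<le> 0"
    using z assms pi_gt_zero by (intro mult_nonneg_nonpos) linarith+
  then show "\<exists>d. ((\<lambda>x. x * sin x + cos x) has_real_derivative d) (at z) \<and> d \<le> 0"
    by (intro exI[of _ "z * cos z"]) (auto intro!: derivative_eq_intros)
qed

text \<open>The tangent at the critical angle \<open>\<beta>\<close> passes through the origin and
  lies strictly below \<open>gw_h\<close> at every other point of \<open>(0, 1]\<close>. Its contact
  point \<open>t0\<close> is therefore the unique minimizer of \<open>gw_h t / t\<close>, so the
  description defining \<open>gw_gamma\<close> denotes \<open>t0\<close>.\<close>

lemma gw_gamma_le_imp:
  assumes "gw_gamma \<le> t" "t \<le> 1"
  shows "0 < t" "pi / 2 < arccos (1 - 2 * t)"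
    "arccos (1 - 2 * t) * sin (arccos (1 - 2 * t)) + cos (arccos (1 - 2 * t)) \<le> 1"
proof -
  obtain \<beta> :: real where \<beta>: "pi / 2 < \<beta>" "\<beta> < pi" "\<beta> * sin \<beta> + cos \<beta> = 1"
    using critical_angle_exists .
  define t0 where "t0 = (1 - cos \<beta>) / 2"
  have "cos \<beta> < 0"
    using cos_monotone_0_pi[of "pi / 2" \<beta>] \<beta> by simp
  then have t0: "1 / 2 < t0" "t0 \<le> 1" "0 < t0"
    using cos_ge_minus_one[of \<beta>] unfolding t0_def by auto
  have arccos_t0: "arccos (1 - 2 * t0) = \<beta>"
    using \<beta> pi_gt_zero by (simp add: t0_def field_simps arccos_cos)
  have sin_pos: "0 < sin \<beta>"
    using \<beta> pi_gt_zero by (intro sin_gt_zero) linarith+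
  have value_t0: "gw_h t0 / t0 = 2 / (pi * sin \<beta>)"
  proof -
    have h_t0: "gw_h t0 = \<beta> / pi" by (simp only: gw_h_def arccos_t0)
    have "2 * t0 = \<beta> * sin \<beta>" using \<beta>(3) by (simp add: t0_def)
    then show ?thesis
      unfolding h_t0 using t0 sin_pos by (simp add: field_simps)
  qed
  have less: "gw_h t0 / t0 < gw_h s / s" if s: "s \<in> {0<..1}" "s \<noteq> t0" for s
  proof -
    define \<theta> where "\<theta> = arccos (1 - 2 * s)"
    have cos_\<theta>: "cos \<theta> = 1 - 2 * s"
      using s by (simp add: \<theta>_def cos_arccos)
    have "0 \<le> \<theta>" "\<theta> \<le> pi"
      using s by (auto simp: \<theta>_def intro!: arccos_lbound arccos_ubound)
    moreover have "\<theta> \<noteq> 0" "\<theta> \<noteq> \<beta>"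
      using s cos_\<theta> by (auto simp: t0_def)
    ultimately have "1 < \<theta> * sin \<beta> + cos \<theta>"
      using tangent_angle_less[of \<beta> \<theta>] \<beta> by auto
    then have "2 * s < \<theta> * sin \<beta>"
      using cos_\<theta> by simp
    then show ?thesis
      unfolding value_t0 using s sin_pos by (simp add: gw_h_def \<theta>_def field_simps)
  qed
  have "gw_gamma = t0"
    unfolding gw_gamma_def
  proof (rule the_equality)
    show "is_arg_min (\<lambda>t. gw_h t / t) (\<lambda>t. t \<in> {0<..1}) t0"
      using t0 less unfolding is_arg_min_def by (metis greaterThanAtMost_iff less_asym less_irrefl)
    show "s = t0" if "is_arg_min (\<lambda>t. gw_h t / t) (\<lambda>t. t \<in> {0<..1}) s" for s
      using that t0 less[of s] unfolding is_arg_min_def by (metis greaterThanAtMost_iff)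
  qed
  then have le: "t0 \<le> t" using assms by simp
  then show "0 < t" using t0 by simp
  have ge: "\<beta> \<le> arccos (1 - 2 * t)"
    unfolding arccos_t0[symmetric] using le assms t0 by (intro arccos_le_arccos) auto
  then show "pi / 2 < arccos (1 - 2 * t)" using \<beta> by simp
  show "arccos (1 - 2 * t) * sin (arccos (1 - 2 * t)) + cos (arccos (1 - 2 * t)) \<le> 1"
    using mult_sin_add_cos_antimono[OF _ ge] \<beta> arccos_ubound[of "1 - 2 * t"] assms \<open>0 < t\<close> by simp
qed

text \<open>The first property of \<open>c\<close> expresses that the tangent is nonpositive at 0.
  The endpoint \<open>A = 1\<close> is left out because \<open>gw_h\<close> has a vertical tangent
  there.\<close>

lemma gw_h_tangent:
  assumes "gw_gamma \<le> A" "A < 1"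
  obtains c where "gw_h A \<le> c * A" "\<And>t. t \<in> {0..1} \<Longrightarrow> gw_h A + c * (t - A) \<le> gw_h t"
proof -
  define \<alpha> where "\<alpha> = arccos (1 - 2 * A)"
  have A: "0 < A" and \<alpha>: "pi / 2 < \<alpha>" "\<alpha> * sin \<alpha> + cos \<alpha> \<le> 1"
    using gw_gamma_le_imp[of A] assms by (auto simp: \<alpha>_def)
  have cos_\<alpha>: "cos \<alpha> = 1 - 2 * A"
    using A assms by (simp add: \<alpha>_def cos_arccos)
  have "\<alpha> \<le> pi" using A assms by (auto simp: \<alpha>_def intro!: arccos_ubound)
  moreover have "\<alpha> \<noteq> pi" using cos_\<alpha> assms by auto
  ultimately have "\<alpha> < pi" by simp
  then have sin_pos: "0 < sin \<alpha>"
    using \<alpha> pi_gt_zero by (intro sin_gt_zero) linarith+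
  have h_A: "gw_h A = \<alpha> / pi" by (simp add: gw_h_def \<alpha>_def)
  \<comment> \<open>The derivative of \<open>gw_h\<close> at \<open>A\<close>, since
    \<open>sqrt (1 - (1 - 2 * A)\<^sup>2) = sin \<alpha>\<close>.\<close>
  define c where "c = 2 / (pi * sin \<alpha>)"
  have "gw_h A \<le> c * A"
    using \<alpha>(2) cos_\<alpha> sin_pos by (simp add: h_A c_def field_simps)
  moreover have "gw_h A + c * (t - A) \<le> gw_h t" if t: "t \<in> {0..1}" for t
  proof -
    define \<theta> where "\<theta> = arccos (1 - 2 * t)"
    have cos_\<theta>: "cos \<theta> = 1 - 2 * t"
      using t by (simp add: \<theta>_def cos_arccos)
    have \<theta>: "0 \<le> \<theta>" "\<theta> \<le> pi"
      using t by (auto simp: \<theta>_def intro!: arccos_lbound arccos_ubound)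
    have "\<alpha> * sin \<alpha> + cos \<alpha> \<le> \<theta> * sin \<alpha> + cos \<theta>"
    \<comment> \<open>The strict inequality omits both angles: at 0 the claim is the condition on
      \<open>\<alpha>\<close>, at \<open>\<alpha>\<close> it is an equality.\<close>
    proof (cases "\<theta> = 0 \<or> \<theta> = \<alpha>")
      case True
      then show ?thesis using \<alpha>(2) by auto
    next
      case False
      then show ?thesis
        using tangent_angle_less[of \<alpha> \<theta>] \<alpha> \<theta> \<open>\<alpha> < pi\<close> by simp
    qed
    then have "\<alpha> + 2 * (t - A) / sin \<alpha> \<le> \<theta>"
      using cos_\<alpha> cos_\<theta> sin_pos by (simp add: field_simps)
    then have "(\<alpha> + 2 * (t - A) / sin \<alpha>) / pi \<le> \<theta> / pi"
      by (intro divide_right_mono) auto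
    then show ?thesis
      unfolding h_A c_def by (simp add: add_divide_distrib gw_h_def \<theta>_def mult.commute)
  qed
  ultimately show thesis using that by blast
qed

section \<open>Separation of two vectors by a random hyperplane\<close>

text \<open>Cauchy's functional equation, with nonnegativity in place of continuity. The deviation
  \<open>g\<close> from the linear function is additive, vanishes at \<open>a\<close> and
  \<open>a / 2\<close>, and is bounded by \<open>f a\<close>. Since
  \<open>g y = g (2 * y) / 2\<close> and shifts by \<open>a / 2\<close> do not change
  \<open>g\<close>, the bound can be halved repeatedly.\<close>

lemma additive_nonneg_on_interval_linear:
  fixes f :: "real \<Rightarrow> real"
  assumes nonneg: "\<And>x. 0 \<le> x \<Longrightarrow> x \<le> a \<Longrightarrow> 0 \<le> f x"
    and add: "\<And>x y. 0 \<le> x \<Longrightarrow> 0 \<le> y \<Longrightarrow> x + y \<le> a \<Longrightarrow> f (x + y) = f x + f y"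
    and x: "0 \<le> x" "x \<le> a" and "0 < a"
  shows "f x = f a * x / a"
proof -
  define g where "g x = f x - f a * x / a" for x
  have g_add: "g (x + y) = g x + g y" if "0 \<le> x" "0 \<le> y" "x + y \<le> a" for x y
    using add[OF that] by (simp add: g_def add_divide_distrib ring_distribs)
  have "g a = 0" using \<open>0 < a\<close> by (simp add: g_def)
  then have g_half: "g (a / 2) = 0"
    using g_add[of "a / 2" "a / 2"] \<open>0 < a\<close> by simp
  have "\<bar>g x\<bar> \<le> f a / 2 ^ k" if "0 \<le> x" "x \<le> a" for x k
    using that
  proof (induction k arbitrary: x)
    case 0
    have "f a = f x + f (a - x)" using add[of x "a - x"] 0 by simp
    moreover have "0 \<le> f a * x / a"
      using 0 \<open>0 < a\<close> nonneg[of a] by simp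
    moreover have "f a * x / a \<le> f a"
      using 0 \<open>0 < a\<close> nonneg[of a] mult_left_mono[of x a "f a"] by (auto simp: divide_le_eq)
    ultimately show ?case
      using nonneg[of x] nonneg[of "a - x"] 0 unfolding g_def power_0 div_by_1 by linarith
  next
    case (Suc k)
    have half: "\<bar>g y\<bar> \<le> f a / 2 ^ Suc k" if "0 \<le> y" "y \<le> a / 2" for y
      using Suc.IH[of "2 * y"] g_add[of y y] that by (simp add: field_simps abs_mult)
    show ?case
    proof (cases "x \<le> a / 2")
      case True
      then show ?thesis using half Suc.prems by simp
    next
      case False
      then have "g x = g (x - a / 2)"
        using g_add[of "a / 2" "x - a / 2"] g_half Suc.prems \<open>0 < a\<close> by simp
      then show ?thesis using half[of "x - a / 2"] False Suc.prems by simp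
    qed
  qed
  then have "\<bar>g x\<bar> \<le> f a / 2 ^ k" for k using x by simp
  moreover have "(\<lambda>k. f a / 2 ^ k) \<longlonglongrightarrow> 0"
    using tendsto_mult[OF tendsto_const LIMSEQ_realpow_zero[of "1 / 2 :: real"], of "f a"]
    by (simp add: power_one_over field_simps)
  ultimately have "\<bar>g x\<bar> \<le> 0"
    by (intro LIMSEQ_le_const) auto
  then show ?thesis by (simp add: g_def)
qed

text \<open>The normals whose hyperplane separates \<open>u\<close> from \<open>v\<close>; zero
  counts as the positive side, as in \<open>gw_round\<close>.\<close>

definition sign_split :: "'a::real_inner \<Rightarrow> 'a \<Rightarrow> 'a set"
  where "sign_split u v = {x. (0 \<le> u \<bullet> x) \<noteq> (0 \<le> v \<bullet> x)}"

lemma sets_sign_split [measurable]: "sign_split u v \<in> sets (borel :: 'a::euclidean_space measure)"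
proof -
  have "{x \<in> space borel. (0 \<le> u \<bullet> x) \<noteq> (0 \<le> v \<bullet> x)} \<in> sets (borel :: 'a measure)"
    by measurable
  then show ?thesis by (simp add: sign_split_def)
qed

lemma sets_uniform_sphere [simp, measurable_cong]:
  "sets (uniform_sphere :: 'a::euclidean_space measure) = sets borel"
  by (simp add: uniform_sphere_def)

lemma space_uniform_sphere [simp]: "space (uniform_sphere :: 'a::euclidean_space measure) = UNIV"
  by (simp add: uniform_sphere_def)

lemma measure_uniform_sphere:
  fixes S :: "'a::euclidean_space set"
  assumes [measurable]: "S \<in> sets borel"
  shows "measure uniform_sphere S =
    measure lborel (ball 0 1 \<inter> (\<lambda>x. x /\<^sub>R norm x) -` S) / measure lborel (ball 0 1 :: 'a set)"
proof -
  have norm_meas [measurable]: "(\<lambda>x::'a. x /\<^sub>R norm x) \<in> borel_measurable borel"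
    by measurable
  have pre: "(\<lambda>x::'a. x /\<^sub>R norm x) -` S \<in> sets lborel"
    using measurable_sets[OF norm_meas assms] by simp
  have "emeasure lborel (ball 0 1 :: 'a set) \<noteq> 0"
    using content_ball_pos[of 1 "0::'a"] by (auto simp: measure_def)
  moreover have "emeasure lborel (ball 0 1 :: 'a set) \<noteq> \<infinity>"
    using emeasure_lborel_ball_finite[of "0::'a" 1] by simp
  ultimately show ?thesis
    using pre by (simp add: uniform_sphere_def measure_distr measure_uniform_measure)
qed

text \<open>An orthogonal map commutes with radial projection and preserves the unit ball and
  Lebesgue measure, so the cones over \<open>S\<close> and its preimage have equal volume in the
  ball.\<close>

lemma measure_uniform_sphere_orthogonal_vimage:
  fixes f :: "real ^ 'n::{finite,wellorder} \<Rightarrow> real ^ 'n::_"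
  assumes f: "orthogonal_transformation f" and S: "S \<in> sets borel"
  shows "measure uniform_sphere (f -` S) = measure uniform_sphere S"
proof -
  have lin: "linear f" and norm_f: "\<And>x. norm (f x) = norm x" and "surj f"
    using f by (auto simp: orthogonal_transformation orthogonal_transformation_surj)
  have f_borel: "f \<in> borel_measurable borel"
    using lin by (intro borel_measurable_continuous_onI linear_continuous_on)
      (simp add: linear_conv_bounded_linear)
  define T where "T = (\<lambda>x. x /\<^sub>R norm x) -` S"
  have "(\<lambda>x::real ^ 'n::_. x /\<^sub>R norm x) \<in> borel_measurable borel" by measurable
  from measurable_sets[OF this S] have T: "T \<in> sets borel" by (simp add: T_def)
  have fT: "f -` T \<in> sets borel" using measurable_sets[OF f_borel T] by simp
  have fS: "f -` S \<in> sets borel" using measurable_sets[OF f_borel S] by simp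
  have "(\<lambda>x. x /\<^sub>R norm x) -` (f -` S) = f -` T"
    by (auto simp: T_def norm_f linear_cmul[OF lin])
  moreover have "measure lborel (ball 0 1 \<inter> f -` T) = measure lborel (ball 0 1 \<inter> T)"
  proof -
    have "ball 0 1 \<inter> T = f ` (ball 0 1 \<inter> f -` T)"
    proof (intro equalityI subsetI)
      fix y assume "y \<in> ball 0 1 \<inter> T"
      moreover obtain x where "y = f x" using \<open>surj f\<close> by (meson surjD)
      ultimately show "y \<in> f ` (ball 0 1 \<inter> f -` T)" by (auto simp: norm_f)
    qed (auto simp: norm_f)
    moreover have "ball 0 1 \<inter> f -` T \<in> lmeasurable"
      using fT by (intro fmeasurable_Int_fmeasurable) auto
    ultimately have "measure lebesgue (ball 0 1 \<inter> T) = measure lebesgue (ball 0 1 \<inter> f -` T)"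
      using measure_orthogonal_image[OF f] by simp
    then show ?thesis using T fT by simp
  qed
  ultimately show ?thesis
    using measure_uniform_sphere[OF S] measure_uniform_sphere[OF fS] by (simp add: T_def)
qed

lemma measure_sign_split_orthogonal:
  fixes f :: "real ^ 'n::{finite,wellorder} \<Rightarrow> real ^ 'n::_"
  assumes "orthogonal_transformation f"
  shows "measure uniform_sphere (sign_split (f u) (f v)) = measure uniform_sphere (sign_split u v)"
proof -
  have "f -` sign_split (f u) (f v) = sign_split u v"
    using assms by (auto simp: sign_split_def orthogonal_transformation_def)
  then show ?thesis
    using measure_uniform_sphere_orthogonal_vimage[OF assms sets_sign_split] by metis
qed

lemma AE_uniform_sphere_inner_nonzero:
  fixes u :: "'a::euclidean_space"
  assumes "u \<noteq> 0"
  shows "AE x in uniform_sphere. u \<bullet> x \<noteq> 0"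
proof -
  have "{x. u \<bullet> x = 0} \<in> null_sets lebesgue"
    using negligible_hyperplane[of u 0] assms by (simp add: negligible_iff_null_sets)
  then have "AE x in lborel. u \<bullet> x \<noteq> 0"
    by (subst AE_completion_iff[symmetric]) (auto dest: AE_not_in)
  then have "AE x in uniform_measure lborel (ball 0 1). u \<bullet> (x /\<^sub>R norm x) \<noteq> 0"
    by (intro AE_uniform_measureI) (auto elim!: eventually_mono)
  then show ?thesis
    unfolding uniform_sphere_def by (subst AE_distr_iff) auto
qed

text \<open>For orthonormal \<open>a\<close> and \<open>b\<close>, the rotation by
  \<open>\<phi>\<close> in their plane. Adding to \<open>x\<close> a correction inside the plane
  fixes the orthogonal complement without extending \<open>a\<close>, \<open>b\<close> to a
  basis.\<close>

definition plane_rotation :: "'a::real_inner \<Rightarrow> 'a \<Rightarrow> real \<Rightarrow> 'a \<Rightarrow> 'a"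
  where "plane_rotation a b \<phi> x = x
    + ((cos \<phi> - 1) * (x \<bullet> a) - sin \<phi> * (x \<bullet> b)) *\<^sub>R a
    + (sin \<phi> * (x \<bullet> a) + (cos \<phi> - 1) * (x \<bullet> b)) *\<^sub>R b"

lemma orthogonal_transformation_plane_rotation:
  fixes a b :: "'a::euclidean_space"
  assumes "norm a = 1" "norm b = 1" "a \<bullet> b = 0"
  shows "orthogonal_transformation (plane_rotation a b \<phi>)"
  unfolding orthogonal_transformation_def
proof (intro conjI allI)
  show "linear (plane_rotation a b \<phi>)"
    by (intro linearI) (simp_all add: plane_rotation_def inner_add_left algebra_simps)
  fix v w
  have ab: "a \<bullet> a = 1" "b \<bullet> b = 1" "a \<bullet> b = 0" "b \<bullet> a = 0"
    using assms by (auto simp: norm_eq_1 inner_commute)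
  have sq: "sin \<phi> * sin \<phi> = 1 - cos \<phi> * cos \<phi>"
    using sin_cos_squared_add[of \<phi>] by (simp add: power2_eq_square)
  define c s p q p' q' where "c = cos \<phi>" and "s = sin \<phi>" and "p = v \<bullet> a" and "q = v \<bullet> b"
    and "p' = w \<bullet> a" and "q' = w \<bullet> b"
  \<comment> \<open>Only the coordinates along \<open>a\<close> and \<open>b\<close> survive in the
    difference, which turns out to be a multiple of \<open>s * s + c * c - 1\<close>.\<close>
  have "plane_rotation a b \<phi> v \<bullet> plane_rotation a b \<phi> w - v \<bullet> w =
    ((c - 1) * p' - s * q') * p + (s * p' + (c - 1) * q') * q
    + ((c - 1) * p - s * q) * p' + (s * p + (c - 1) * q) * q'
    + ((c - 1) * p - s * q) * ((c - 1) * p' - s * q')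
    + (s * p + (c - 1) * q) * (s * p' + (c - 1) * q')"
    unfolding plane_rotation_def c_def s_def p_def q_def p'_def q'_def
    by (simp add: inner_add_left inner_add_right ab inner_commute[of a w] inner_commute[of b w]
        algebra_simps)
  also have "\<dots> = (s * s + c * c - 1) * (p * p' + q * q')"
    by algebra
  also have "\<dots> = 0" using sq by (simp add: c_def s_def)
  finally show "plane_rotation a b \<phi> v \<bullet> plane_rotation a b \<phi> w = v \<bullet> w" by simp
qed

lemma plane_rotation_circle:
  assumes "norm a = 1" "norm b = 1" "a \<bullet> b = 0"
  shows "plane_rotation a b \<phi> (cos t *\<^sub>R a + sin t *\<^sub>R b) = cos (t + \<phi>) *\<^sub>R a + sin (t + \<phi>) *\<^sub>R b"
proof -
  have "a \<bullet> a = 1" "b \<bullet> b = 1" "b \<bullet> a = 0"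
    using assms by (auto simp: norm_eq_1 inner_commute)
  then show ?thesis
    using assms(3)
    by (simp add: plane_rotation_def inner_add_left cos_add sin_add algebra_simps)
qed

lemma sign_split_self [simp]: "sign_split u u = {}"
  by (simp add: sign_split_def)

text \<open>Off the hyperplane orthogonal to \<open>u\<close>, a null set, \<open>u\<close> and
  \<open>- u\<close> have opposite signs, so exactly one of them is separated from
  \<open>v\<close>.\<close>

lemma measure_sign_split_uminus:
  fixes u v :: "'a::euclidean_space"
  assumes "u \<noteq> 0"
  shows "measure uniform_sphere (sign_split u v) + measure uniform_sphere (sign_split v (- u)) = 1"
proof -
  interpret prob_space "uniform_sphere :: 'a measure" by (rule prob_space_uniform_sphere)
  have "measure uniform_sphere (sign_split v (- u)) = measure uniform_sphere (- sign_split u v)"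
    using AE_uniform_sphere_inner_nonzero[OF assms]
    by (intro measure_eq_AE) (auto elim!: eventually_mono simp: sign_split_def)
  also have "\<dots> = 1 - measure uniform_sphere (sign_split u v)"
    using prob_compl[of "sign_split u v"] by (simp add: Compl_eq_Diff_UNIV)
  finally show ?thesis by simp
qed

text \<open>
  By rotation invariance the probability depends only on the angle, and it is additive in
  the angle: a hyperplane cannot separate the middle one of three directions from both others.
\<close>

lemma measure_sign_split_circle:
  fixes a b :: "real ^ 'n::{finite,wellorder}"
  assumes ab: "norm a = 1" "norm b = 1" "a \<bullet> b = 0" and t: "0 \<le> t" "t \<le> pi"
  shows "measure uniform_sphere (sign_split a (cos t *\<^sub>R a + sin t *\<^sub>R b)) = t / pi"
proof -
  interpret prob_space "uniform_sphere :: (real ^ 'n::_) measure" by (rule prob_space_uniform_sphere)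
  define d where "d t = cos t *\<^sub>R a + sin t *\<^sub>R b" for t
  define p where "p t = prob (sign_split (d 0) (d t))" for t
  have "a \<noteq> 0" using ab by auto
  have d0: "d 0 = a" and d_pi: "d pi = - a" by (auto simp: d_def)
  have shift: "prob (sign_split (d r) (d (r + s))) = p s" for r s
    using measure_sign_split_orthogonal[OF orthogonal_transformation_plane_rotation[OF ab, of r],
        of "d 0" "d s"]
    by (simp add: p_def d_def plane_rotation_circle[OF ab] add.commute
        plane_rotation_circle[OF ab, where t = 0, simplified])
  have add: "p (r + s) = p r + p s" if rs: "0 \<le> r" "0 \<le> s" "r + s \<le> pi" for r s
  \<comment> \<open>If \<open>r + s = pi\<close>, the combination used below degenerates because
    \<open>sin (r + s) = 0\<close>. Then \<open>d (r + s) = - d 0\<close>, and complementarity for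
    opposite vectors gives the claim.\<close>
  proof (cases "r + s = pi")
    case True
    then show ?thesis
      using measure_sign_split_uminus[OF \<open>a \<noteq> 0\<close>, of a] measure_sign_split_uminus[OF \<open>a \<noteq> 0\<close>, of "d r"]
        shift[of r s] by (simp add: p_def d0 d_pi)
  next
    case False
    show ?thesis
    proof (cases "r = 0 \<or> s = 0")
      case True
      then show ?thesis by (auto simp: p_def)
    next
      case False
      then have sins: "0 < sin r" "0 < sin s" "0 < sin (r + s)"
        using rs \<open>r + s \<noteq> pi\<close> by (auto intro!: sin_gt_zero)
      \<comment> \<open>All three sines are positive, so \<open>d r\<close> is a positive
        combination of \<open>d 0\<close> and \<open>d (r + s)\<close>: where these two fall on the
        same side, so does \<open>d r\<close>.\<close>
      have "sin (r + s) *\<^sub>R d r = sin s *\<^sub>R d 0 + sin r *\<^sub>R d (r + s)"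
      proof -
        have "sin (r + s) * cos r = sin s + sin r * cos (r + s)"
          using sin_diff[of "r + s" r] by simp
        then show ?thesis
          by (simp add: d_def scaleR_add_right flip: scaleR_add_left) (simp add: scaleR_add_left)
      qed
      then have mid: "sin (r + s) * (d r \<bullet> x) = sin s * (d 0 \<bullet> x) + sin r * (d (r + s) \<bullet> x)" for x
        by (metis inner_add_left inner_scaleR_left)
      have same: "0 \<le> d r \<bullet> x \<longleftrightarrow> 0 \<le> d 0 \<bullet> x" if "0 \<le> d 0 \<bullet> x \<longleftrightarrow> 0 \<le> d (r + s) \<bullet> x" for x
      proof (cases "0 \<le> d 0 \<bullet> x")
        case True
        then have "0 \<le> sin (r + s) * (d r \<bullet> x)"
          unfolding mid using that sins by simp
        then show ?thesis using True sins by (simp add: zero_le_mult_iff)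
      next
        case False
        then have "sin (r + s) * (d r \<bullet> x) < 0"
          unfolding mid using that sins by (intro add_neg_neg mult_pos_neg) auto
        then show ?thesis using False sins by (simp add: mult_less_0_iff)
      qed
      have "sign_split (d 0) (d (r + s)) = sign_split (d 0) (d r) \<union> sign_split (d r) (d (r + s))"
        "sign_split (d 0) (d r) \<inter> sign_split (d r) (d (r + s)) = {}"
        using same by (auto simp: sign_split_def)
      then show ?thesis
        unfolding p_def using shift[of r s] by (simp add: finite_measure_Union p_def)
    qed
  qed
  have "p pi = 1"
    using measure_sign_split_uminus[OF \<open>a \<noteq> 0\<close>, of a] by (simp add: p_def d0 d_pi)
  moreover have "p t = p pi * t / pi"
    using add t by (intro additive_nonneg_on_interval_linear) (auto simp: p_def)
  ultimately show ?thesis by (simp add: p_def d_def)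
qed

text \<open>Gram-Schmidt yields a unit vector \<open>b\<close> orthogonal to \<open>u\<close> such
  that \<open>v\<close> lies on the circle through \<open>u\<close> and \<open>b\<close> at angle
  \<open>arccos (u \<bullet> v)\<close>. Parallel vectors, the only ones in dimension one, give no
  \<open>b\<close> and are treated directly.\<close>

theorem measure_sign_split:
  fixes u v :: "real ^ 'n::{finite,wellorder}"
  assumes u: "norm u = 1" and v: "norm v = 1"
  shows "measure uniform_sphere (sign_split u v) = arccos (u \<bullet> v) / pi"
proof -
  have bound: "\<bar>u \<bullet> v\<bar> \<le> 1"
    using Cauchy_Schwarz_ineq2[of u v] assms by simp
  define w where "w = v - (u \<bullet> v) *\<^sub>R u"
  have uu: "u \<bullet> u = 1" and vv: "v \<bullet> v = 1" using assms by (auto simp: norm_eq_1)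
  show ?thesis
  proof (cases "w = 0")
    case True
    then have v_eq: "v = (u \<bullet> v) *\<^sub>R u" by (simp add: w_def)
    then have "\<bar>u \<bullet> v\<bar> = 1" using u v by (metis mult.right_neutral norm_scaleR)
    then consider "u \<bullet> v = 1" | "u \<bullet> v = - 1" by linarith
    then show ?thesis
    proof cases
      case 1
      then show ?thesis using v_eq by simp
    next
      case 2
      then have "v = - u" using v_eq by simp
      moreover have "u \<noteq> 0" using u by auto
      ultimately show ?thesis
        using measure_sign_split_uminus[of u u] uu by simp
    qed
  next
    case False
    define \<theta> where "\<theta> = arccos (u \<bullet> v)"
    define b where "b = w /\<^sub>R norm w"
    have "w \<bullet> w = 1 - (u \<bullet> v)\<^sup>2"
      by (simp add: w_def inner_diff_left inner_diff_right uu vv inner_commute power2_eq_square)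
    then have "norm w = sin \<theta>"
      using bound by (simp add: \<theta>_def norm_eq_sqrt_inner sin_arccos_abs)
    moreover have "cos \<theta> = u \<bullet> v"
      using bound by (simp add: \<theta>_def cos_arccos_abs)
    ultimately have "v = cos \<theta> *\<^sub>R u + sin \<theta> *\<^sub>R b"
      using False
      by (metis add.commute b_def diff_add_cancel norm_eq_zero right_inverse scaleR_one
          scaleR_scaleR w_def)
    moreover have "norm b = 1" "u \<bullet> b = 0"
      using False uu by (auto simp: b_def w_def inner_diff_right)
    moreover have "0 \<le> \<theta>" "\<theta> \<le> pi"
      using bound by (auto simp: \<theta>_def abs_le_iff intro!: arccos_lbound arccos_ubound)
    ultimately show ?thesis
      using measure_sign_split_circle[OF u, of b \<theta>] by (simp add: \<theta>_def)
  qed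
qed

section \<open>The rounding guarantee\<close>

lemma finite_sign_vectors: "finite (sign_vectors :: (real ^ 'n) set)"
proof (rule finite_subset)
  show "(sign_vectors :: (real ^ 'n) set) \<subseteq> vec_lambda ` (UNIV \<rightarrow>\<^sub>E {-1, 1})"
  proof
    fix y :: "real ^ 'n" assume "y \<in> sign_vectors"
    then have "vec_nth y \<in> UNIV \<rightarrow>\<^sub>E {-1, 1}" by (auto simp: sign_vectors_def)
    then show "y \<in> vec_lambda ` (UNIV \<rightarrow>\<^sub>E {-1, 1})"
      by (intro image_eqI[of _ _ "vec_nth y"]) (simp add: vec_lambda_eta)
  qed
qed (auto intro!: finite_PiE)

text \<open>The Frobenius product counts every pair twice and the diagonal vanishes, which turns the
  factor 1/4 into 1/2.\<close>

lemma sdp_objective_upper_triangle: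
  fixes W Y :: "real ^ 'n::{finite,wellorder} ^ 'n::_"
  assumes W: "transpose W = W" and Y: "transpose Y = Y" "\<And>i. Y $ i $ i = 1"
  shows "sdp_objective Y W = 1/2 * (\<Sum>(i, j) \<in> {(i, j). i < j}. W $ i $ j * (1 - Y $ i $ j))"
proof -
  define f where "f = (\<lambda>(i, j). W $ i $ j * (1 - Y $ i $ j))"
  have f_sym: "f (prod.swap x) = f x" for x
    using W Y(1)
    by (cases x) (metis (no_types, lifting) f_def old.prod.case swap_simp transpose_def
        vec_lambda_beta)
  have "W \<bullet> ((\<chi> i j. 1) - Y) = (\<Sum>i\<in>UNIV. \<Sum>j\<in>UNIV. f (i, j))"
    by (simp add: inner_vec_def f_def)
  also have "\<dots> = sum f UNIV"
    by (simp add: sum.cartesian_product)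
  also have "UNIV = {(i, j). i < j} \<union> {(i, j). j < i} \<union> {(i, j). i = (j :: 'n)}"
    by auto
  also have "sum f \<dots> = sum f {(i, j). i < j} + sum f {(i, j). j < i} + sum f {(i, j). i = j}"
    by (subst sum.union_disjoint; (subst sum.union_disjoint)?) auto
  also have "sum f {(i, j). i = j} = 0"
    using Y(2) by (intro sum.neutral) (auto simp: f_def)
  also have "sum f {(i, j). j < i} = sum f {(i, j). i < j}"
    by (rule sum.reindex_bij_witness[of _ prod.swap prod.swap]) (auto simp: f_sym)
  finally show ?thesis by (simp add: sdp_objective_def f_def)
qed

lemma sdp_feasible_sign_vector:
  fixes y :: "real ^ 'n"
  assumes "y \<in> sign_vectors"
  shows "sdp_feasible (\<chi> i j. y $ i * y $ j)"
proof -
  have "(\<chi> i j. y $ i * y $ j) *v x = (y \<bullet> x) *\<^sub>R y" for x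
    by (simp add: vec_eq_iff matrix_vector_mult_def inner_vec_def sum_distrib_left
        sum_distrib_right mult_ac)
  then have "0 \<le> x \<bullet> ((\<chi> i j. y $ i * y $ j) *v x)" for x
    by (simp add: inner_commute)
  moreover have "y $ i * y $ i = 1" for i
    using assms by (auto simp: sign_vectors_def) (metis mult_minus_left mult_1 minus_minus)
  ultimately show ?thesis
    by (simp add: sdp_feasible_def positive_semidefinite_def transpose_def mult.commute)
qed

text \<open>A real \<open>INF\<close> is a lower bound only of a set bounded below; an attained
  minimum ensures this.\<close>

lemma bdd_below_if_arg_min:
  fixes f :: "'a \<Rightarrow> 'b::linorder"
  assumes "\<exists>x. is_arg_min f (\<lambda>x. x \<in> S) x"
  shows "bdd_below (f ` S)"
  using assms by (auto simp: is_arg_min_def not_less intro: bdd_belowI2)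

text \<open>The SDP is a relaxation: a maximizing sign vector \<open>y\<close> gives the feasible
  rank-one matrix with entries \<open>y $ i * y $ j\<close>, whose SDP objective equals the cut
  objective for every \<open>W\<close>.\<close>

lemma rp_value_le_sdp_value:
  fixes \<W> :: "(real ^ 'n::{finite,wellorder} ^ 'n::_) set"
  assumes symmetric: "\<And>W. W \<in> \<W> \<Longrightarrow> transpose W = W" and "\<W> \<noteq> {}"
    and rp_min_attained:
      "\<And>y. y \<in> sign_vectors \<Longrightarrow> \<exists>W. is_arg_min (rp_objective y) (\<lambda>W. W \<in> \<W>) W"
    and Yhat_optimal: "is_arg_max (\<lambda>Y. INF W \<in> \<W>. sdp_objective Y W) sdp_feasible Yhat"
  shows "rp_value \<W> \<le> (INF W \<in> \<W>. sdp_objective Yhat W)"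
proof -
  let ?S = "sign_vectors :: (real ^ 'n::_) set"
  define M where "M = Max ((\<lambda>y. INF W \<in> \<W>. rp_objective y W) ` ?S)"
  have "(\<chi> i. 1) \<in> ?S" by (simp add: sign_vectors_def)
  then have "M \<in> (\<lambda>y. INF W \<in> \<W>. rp_objective y W) ` ?S"
    unfolding M_def using finite_sign_vectors by (intro Max_in) auto
  then obtain y where y: "y \<in> ?S" and M: "M = (INF W \<in> \<W>. rp_objective y W)" by auto
  define Y where "Y = (\<chi> i j. y $ i * y $ j)"
  have Y: "sdp_feasible Y" unfolding Y_def by (rule sdp_feasible_sign_vector[OF y])
  have obj: "sdp_objective Y W = 1/2 * rp_objective y W" if "W \<in> \<W>" for W
    using sdp_objective_upper_triangle[OF symmetric[OF that], of Y] Y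
    by (simp add: sdp_feasible_def positive_semidefinite_def rp_objective_def Y_def)
  have bdd: "bdd_below (rp_objective y ` \<W>)"
    by (rule bdd_below_if_arg_min[OF rp_min_attained[OF y]])
  have "rp_value \<W> = 1/2 * M" by (simp add: rp_value_def M_def)
  also have "\<dots> \<le> (INF W \<in> \<W>. sdp_objective Y W)"
    using \<open>\<W> \<noteq> {}\<close> cINF_lower[OF bdd] by (intro cINF_greatest) (auto simp: M obj)
  also have "\<dots> \<le> (INF W \<in> \<W>. sdp_objective Yhat W)"
    using Yhat_optimal Y by (auto simp: is_arg_max_def not_less)
  finally show ?thesis .
qed

text \<open>By linearity of expectation: an edge is cut exactly when \<open>r\<close> lies in the
  \<open>sign_split\<close> of its two columns, and the separation probability is
  \<open>gw_h\<close> of the SDP contribution.\<close>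

lemma expectation_cut_value_gw_round:
  fixes W U :: "real ^ 'n::{finite,wellorder} ^ 'n::_"
  assumes unit: "\<And>i. norm (column i U) = 1"
  shows "(\<integral>r. cut_value W (gw_round U r) \<partial>uniform_sphere) =
    (\<Sum>(i, j) \<in> {(i, j). i < j}. W $ i $ j * gw_h ((1 - column i U \<bullet> column j U) / 2))"
proof -
  interpret prob_space "uniform_sphere :: (real ^ 'n::_) measure" by (rule prob_space_uniform_sphere)
  have cut: "cut_value W (gw_round U r) = (\<Sum>(i, j) \<in> {(i, j). i < j}.
      W $ i $ j * indicator (sign_split (column i U) (column j U)) r)" for r
    by (auto simp: cut_value_def gw_round_def sign_split_def intro!: sum.cong)
  show ?thesis
    unfolding cut case_prod_beta
    by (subst Bochner_Integration.integral_sum)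
      (auto simp: measure_sign_split[OF unit unit] gw_h_def diff_divide_distrib less_top[symmetric]
        intro!: sum.cong integrable_mult_right integrable_real_indicator)
qed

lemma weighted_gw_h_ge:
  fixes w t :: "'a \<Rightarrow> real"
  assumes "finite I" and w: "\<And>i. i \<in> I \<Longrightarrow> 0 \<le> w i" and t: "\<And>i. i \<in> I \<Longrightarrow> t i \<in> {0..1}"
    and A: "gw_gamma \<le> A" "A \<le> 1" "sum w I * A \<le> (\<Sum>i\<in>I. w i * t i)"
  shows "gw_h A / A * (\<Sum>i\<in>I. w i * t i) \<le> (\<Sum>i\<in>I. w i * gw_h (t i))"
proof -
  let ?w = "sum w I" and ?s = "\<Sum>i\<in>I. w i * t i"
  show ?thesis
  proof (cases "A = 1")
    case True
    \<comment> \<open>No finite tangent slope exists here. A weighted mean of at least 1 forces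
      \<open>t i = 1\<close> wherever \<open>w i\<close> is nonzero, and
      \<open>gw_h 1 = 1\<close>.\<close>
    then have "(\<Sum>i\<in>I. w i * (1 - t i)) \<le> 0"
      using A by (simp add: right_diff_distrib sum_subtractf)
    moreover have terms: "0 \<le> w i * (1 - t i)" if "i \<in> I" for i using w t that by simp
    ultimately have "(\<Sum>i\<in>I. w i * (1 - t i)) = 0"
      using sum_nonneg[of I "\<lambda>i. w i * (1 - t i)"] by force
    then have "\<forall>i\<in>I. w i * (1 - t i) = 0"
      using sum_nonneg_eq_0_iff[of I "\<lambda>i. w i * (1 - t i)"] \<open>finite I\<close> terms by blast
    then have "w i * gw_h (t i) = w i * t i" if "i \<in> I" for i
      using that by (auto simp: gw_h_def)
    then show ?thesis using True by (simp add: gw_h_def)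
  next
    case False
    then have "A < 1" using A by simp
    then obtain c where c: "gw_h A \<le> c * A"
        "\<And>t. t \<in> {0..1} \<Longrightarrow> gw_h A + c * (t - A) \<le> gw_h t"
      using gw_h_tangent[OF A(1)] by metis
    have "0 < A" using gw_gamma_le_imp(1)[OF A(1,2)] .
    \<comment> \<open>The tangent is at least as steep as the chord from the origin to the point at
      \<open>A\<close>, so to the right of \<open>A\<close> it dominates the chord's line. The
      weighted mean of \<open>t\<close> lies there.\<close>
    have "0 \<le> (c - gw_h A / A) * (?s - ?w * A)"
      using c(1) A \<open>0 < A\<close> by (intro mult_nonneg_nonneg) (auto simp: field_simps)
    also have "\<dots> = ?w * gw_h A + c * (?s - ?w * A) - gw_h A / A * ?s"
      using \<open>0 < A\<close> by (simp add: field_simps)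
    finally have "gw_h A / A * ?s \<le> ?w * gw_h A + c * (?s - ?w * A)" by simp
    also have "\<dots> = (\<Sum>i\<in>I. w i * (gw_h A + c * (t i - A)))"
      by (simp add: distrib_left right_diff_distrib mult.left_commute[of _ c] sum.distrib
          sum_subtractf flip: sum_distrib_left sum_distrib_right)
    also have "\<dots> \<le> (\<Sum>i\<in>I. w i * gw_h (t i))"
      using w t c(2) by (intro sum_mono mult_left_mono) auto
    finally show ?thesis .
  qed
qed

theorem theoremA1:
  fixes \<W> :: "(real ^ 'n::{finite,wellorder} ^ 'n::_) set"
    and Yhat U :: "real ^ 'n::_ ^ 'n::_"
    and A :: real
  assumes symmetric: "\<And>W. W \<in> \<W> \<Longrightarrow> transpose W = W"
    and nonneg: "\<And>W i j. W \<in> \<W> \<Longrightarrow> 0 \<le> W $ i $ j"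
    and total_pos: "\<And>W. W \<in> \<W> \<Longrightarrow> 0 < total_weight W"
    and rp_min_attained:
      "\<And>y. y \<in> sign_vectors \<Longrightarrow> \<exists>W. is_arg_min (rp_objective y) (\<lambda>W. W \<in> \<W>) W"
    and sdp_min_attained:
      "\<And>Y. sdp_feasible Y \<Longrightarrow> \<exists>W. is_arg_min (sdp_objective Y) (\<lambda>W. W \<in> \<W>) W"
    and Yhat_optimal: "is_arg_max (\<lambda>Y. INF W \<in> \<W>. sdp_objective Y W) sdp_feasible Yhat"
    and factor: "Yhat = transpose U ** U"
    and rel_min_attained: "\<exists>W. is_arg_min (rel_sdp_cut U) (\<lambda>W. W \<in> \<W>) W"
    and A_def: "A = (INF W \<in> \<W>. rel_sdp_cut U W)"
    and A_large: "A \<ge> gw_gamma"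
  shows "\<forall>W \<in> \<W>. (\<integral>r. cut_value W (gw_round U r) \<partial>uniform_sphere) \<ge> gw_h A / A * rp_value \<W>"
proof
  fix W assume W: "W \<in> \<W>"
  define I where "I = {(i, j). i < (j :: 'n::_)}"
  define t where "t = (\<lambda>(i, j). (1 - column i U \<bullet> column j U) / 2)"
  define w where "w = (\<lambda>(i, j). W $ i $ j)"
  have feasible: "sdp_feasible Yhat" using Yhat_optimal by (simp add: is_arg_max_def)
  have Yhat_nth: "Yhat $ i $ j = column i U \<bullet> column j U" for i j
    by (simp add: factor matrix_matrix_mult_def transpose_def column_def inner_vec_def)
  have unit: "norm (column i U) = 1" for i
    using feasible Yhat_nth[of i i] by (simp add: sdp_feasible_def norm_eq_1)
  have t: "t x \<in> {0..1}" for x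
  proof (cases x)
    case (Pair i j)
    have "\<bar>column i U \<bullet> column j U\<bar> \<le> 1"
      using Cauchy_Schwarz_ineq2[of "column i U" "column j U"] by (simp add: unit)
    then show ?thesis by (auto simp: Pair t_def abs_le_iff)
  qed
  have total: "sum w I = total_weight W" by (simp add: w_def I_def total_weight_def)
  have rel: "rel_sdp_cut U W = (\<Sum>x\<in>I. w x * t x) / sum w I"
    unfolding total by (simp add: rel_sdp_cut_def w_def t_def I_def case_prod_beta)
  have "A \<le> rel_sdp_cut U W"
    unfolding A_def by (rule cINF_lower[OF bdd_below_if_arg_min[OF rel_min_attained] W])
  then have A_le: "sum w I * A \<le> (\<Sum>x\<in>I. w x * t x)"
    using total_pos[OF W] by (simp add: rel total field_simps)
  \<comment> \<open>\<open>A\<close> is at most a weighted mean of numbers in \<open>[0, 1]\<close>;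
    this keeps \<open>1 - 2 * A\<close> in the domain of \<open>arccos\<close>.\<close>
  have A_le_1: "A \<le> 1"
  proof -
    have "(\<Sum>x\<in>I. w x * t x) \<le> sum w I"
      using t nonneg[OF W] by (intro sum_mono mult_left_le) (auto simp: w_def split: prod.split)
    then have "sum w I * A \<le> sum w I * 1" using A_le by linarith
    then show ?thesis using total_pos[OF W] by (simp only: total mult_le_cancel_left_pos)
  qed
  have "0 < A" using gw_gamma_le_imp(1)[OF A_large A_le_1] .
  have "0 \<le> gw_h A"
    using arccos_lbound[of "1 - 2 * A"] \<open>0 < A\<close> A_le_1 by (simp add: gw_h_def)
  \<comment> \<open>The chain passes from the robust value to the worst-case SDP value and then to
    the SDP value of the given \<open>W\<close>; the nonnegative ratio \<open>gw_h A / A\<close>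
    preserves it.\<close>
  have "rp_value \<W> \<le> (INF W \<in> \<W>. sdp_objective Yhat W)"
    using rp_value_le_sdp_value[OF symmetric _ rp_min_attained Yhat_optimal] W by auto
  also have "\<dots> \<le> sdp_objective Yhat W"
    by (rule cINF_lower[OF bdd_below_if_arg_min[OF sdp_min_attained[OF feasible]] W])
  also have "\<dots> = (\<Sum>x\<in>I. w x * t x)"
    using sdp_objective_upper_triangle[OF symmetric[OF W], of Yhat] feasible
    by (simp add: sdp_feasible_def positive_semidefinite_def Yhat_nth w_def t_def I_def
        case_prod_beta sum_divide_distrib)
  finally have "gw_h A / A * rp_value \<W> \<le> gw_h A / A * (\<Sum>x\<in>I. w x * t x)"
    using \<open>0 < A\<close> \<open>0 \<le> gw_h A\<close> by (intro mult_left_mono) auto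
  also have "\<dots> \<le> (\<Sum>x\<in>I. w x * gw_h (t x))"
    using nonneg[OF W] t A_large A_le_1 A_le
    by (intro weighted_gw_h_ge) (auto simp: w_def split: prod.split)
  also have "\<dots> = (\<integral>r. cut_value W (gw_round U r) \<partial>uniform_sphere)"
    by (simp add: expectation_cut_value_gw_round[OF unit] w_def t_def I_def case_prod_beta)
  finally show "gw_h A / A * rp_value \<W> \<le> (\<integral>r. cut_value W (gw_round U r) \<partial>uniform_sphere)" .
qed

end
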